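(* The Cartan canonical connection $C\mathring\Gamma$ of the rheonomic Berwald-Moór metric $\mathring F(t,y)=\sqrt{h^{11}(t)}\,\sqrt[4]{y_1^1y_1^2y_1^3y_1^4}$ has three effective local torsion d-tensors, namely $$P_{(1)i(j)}^{(k)\,(1)}=-\frac13\varkappa_{11}^1C_{i(j)}^{k(1)},\qquad P_{i(j)}^{k(1)}=C_{i(j)}^{k(1)},\qquad R_{(1)1j}^{(k)}=\frac13\left[\frac{d\varkappa_{11}^1}{dt}-\varkappa_{11}^1\varkappa_{11}^1\right]\delta_j^k;$$ the other five torsion d-tensors $T_{1j}^k,\ T_{ij}^k,\ R_{(1)ij}^{(k)},\ P_{(1)1(j)}^{(k)\,(1)},\ S_{(1)(i)(j)}^{(k)(1)(1)}$ vanish identically.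
   Context: All indices $i,j,k,m,p,\dots$ run from $1$ to $4$; repeated indices are summed; $\delta$ with two indices is the Kronecker symbol. Let $h_{11}:\mathbb{R}\to(0,\infty)$ be a smooth function (a Riemannian metric on $\mathbb{R}$), $h^{11}=1/h_{11}$, and $\varkappa_{11}^1=\frac{h^{11}}{2}\frac{dh_{11}}{dt}$. Work in local coordinates $(t,x^i,y_1^i)$ of the $1$-jet space $J^1(\mathbb{R},M^4)$, $M^4$ a $4$-dimensional manifold, on the domain where $y_1^1y_1^2y_1^3y_1^4>0$. Put $g_{ij}=\frac{h_{11}}{2}\frac{\partial^2\mathring F^2}{\partial y_1^i\partial y_1^j}$, with inverse matrix $(g^{jk})$. The nonlinear connection used is $\mathring\Gamma=\left(M_{(1)1}^{(i)}=-\varkappa_{11}^1y_1^i,\ N_{(1)j}^{(i)}=-\frac{\varkappa_{11}^1}{3}\delta_j^i\right)$, with adapted vector fields $$\frac{\delta}{\delta t}=\frac{\partial}{\partial t}+\varkappa_{11}^1y_1^p\frac{\partial}{\partial y_1^p},\qquad \frac{\delta}{\delta x^i}=\frac{\partial}{\partial x^i}+\frac{\varkappa_{11}^1}{3}\frac{\partial}{\partial y_1^i},\qquad \frac{\partial}{\partial y_1^i}.$$ The Cartan canonical connection $C\mathring\Gamma=(\varkappa_{11}^1,G_{j1}^k,L_{jk}^i,C_{j(k)}^{i(1)})$ has adapted components $$G_{j1}^k=\frac{g^{km}}{2}\frac{\delta g_{mj}}{\delta t},\quad L_{jk}^i=\frac{g^{im}}{2}\left(\frac{\delta g_{jm}}{\delta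 x^k}+\frac{\delta g_{km}}{\delta x^j}-\frac{\delta g_{jk}}{\delta x^m}\right),\quad C_{j(k)}^{i(1)}=\frac{g^{im}}{2}\frac{\partial g_{jm}}{\partial y_1^k}.$$ It is the linear connection $\nabla$ on the domain given, in the adapted basis, by $$\nabla_{\delta/\delta t}\frac{\delta}{\delta t}=\varkappa_{11}^1\frac{\delta}{\delta t},\quad \nabla_{\delta/\delta t}\frac{\delta}{\delta x^i}=G_{i1}^k\frac{\delta}{\delta x^k},\quad \nabla_{\delta/\delta t}\frac{\partial}{\partial y_1^i}=\left(G_{i1}^k-\varkappa_{11}^1\delta_i^k\right)\frac{\partial}{\partial y_1^k},$$ $$\nabla_{\delta/\delta x^j}\frac{\delta}{\delta t}=0,\quad \nabla_{\delta/\delta x^j}\frac{\delta}{\delta x^i}=L_{ij}^k\frac{\delta}{\delta x^k},\quad \nabla_{\delta/\delta x^j}\frac{\partial}{\partial y_1^i}=L_{ij}^k\frac{\partial}{\partial y_1^k},$$ $$\nabla_{\partial/\partial y_1^j}\frac{\delta}{\delta t}=0,\quad \nabla_{\partial/\partial y_1^j}\frac{\delta}{\delta x^i}=C_{i(j)}^{k(1)}\frac{\delta}{\delta x^k},\quad \nabla_{\partial/\partial y_1^j}\frac{\partial}{\partial y_1^i}=C_{i(j)}^{k(1)}\frac{\partial}{\partial y_1^k}.$$ With the torsion $\mathbf{T}(X,Y)=\nabla_XY-\nabla_YX-[X,Y]$, the eight torsion d-tensors are the adapted components defined by $$\mathbf{T}\left(\tfrac{\delta}{\delta x^j},\tfrac{\delta}{\delta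 t}\right)=T_{1j}^k\tfrac{\delta}{\delta x^k}+R_{(1)1j}^{(k)}\tfrac{\partial}{\partial y_1^k},\qquad \mathbf{T}\left(\tfrac{\delta}{\delta x^j},\tfrac{\delta}{\delta x^i}\right)=T_{ij}^k\tfrac{\delta}{\delta x^k}+R_{(1)ij}^{(k)}\tfrac{\partial}{\partial y_1^k},$$ $$\mathbf{T}\left(\tfrac{\partial}{\partial y_1^j},\tfrac{\delta}{\delta t}\right)=P_{(1)1(j)}^{(k)\,(1)}\tfrac{\partial}{\partial y_1^k},\qquad \mathbf{T}\left(\tfrac{\partial}{\partial y_1^j},\tfrac{\delta}{\delta x^i}\right)=P_{i(j)}^{k(1)}\tfrac{\delta}{\delta x^k}+P_{(1)i(j)}^{(k)\,(1)}\tfrac{\partial}{\partial y_1^k},$$ $$\mathbf{T}\left(\tfrac{\partial}{\partial y_1^j},\tfrac{\partial}{\partial y_1^i}\right)=S_{(1)(i)(j)}^{(k)(1)(1)}\tfrac{\partial}{\partial y_1^k}.$$ In particular $P_{(1)i(j)}^{(k)\,(1)}=\frac{\partial N_{(1)i}^{(k)}}{\partial y_1^j}-L_{ji}^k$, $R_{(1)1j}^{(k)}=\frac{\delta M_{(1)1}^{(k)}}{\delta x^j}-\frac{\delta N_{(1)j}^{(k)}}{\delta t}$ and $P_{i(j)}^{k(1)}=C_{i(j)}^{k(1)}$. *)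

theory Defs
  imports "HOL-Analysis.Analysis"
begin

text \<open>
  Local coordinates \<open>(t, x, y)\<close> of the 1-jet space. The coordinate indices 1,...,4 are the
  elements of the four-element type \<^typ>\<open>4\<close>, so that \<open>x $ i\<close> is $x^i$ and \<open>y $ i\<close> is $y_1^i$.
  Tensor components are written with upper indices first:
  \<open>G_conn h k j\<close> is $G_{j1}^k$, \<open>L_conn h i j k\<close> is $L_{jk}^i$, \<open>C_conn h i j k\<close> is $C_{j(k)}^{i(1)}$.
\<close>

type_synonym jet = "real \<times> (real ^ 4) \<times> (real ^ 4)"

abbreviation t_coord :: "jet \<Rightarrow> real" where "t_coord p \<equiv> fst p"
abbreviation x_coord :: "4 \<Rightarrow> jet \<Rightarrow> real" where "x_coord i p \<equiv> fst (snd p) $ i"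
abbreviation y_coord :: "4 \<Rightarrow> jet \<Rightarrow> real" where "y_coord i p \<equiv> snd (snd p) $ i"

text \<open>\<open>U\<close> is the image of a chart of the 4-manifold.\<close>

definition jet_domain :: "(real ^ 4) set \<Rightarrow> jet set" where
  "jet_domain U = {p. fst (snd p) \<in> U \<and> (\<Prod>i\<in>UNIV. y_coord i p) > 0}"


text \<open>
  A vector field is given by its coordinate components, i.e. by a map \<^typ>\<open>jet \<Rightarrow> jet\<close>. Only its
  values near points of the (open) domain matter. \<open>vderiv X f\<close> is $X(f)$.
\<close>

type_synonym vfield = "jet \<Rightarrow> jet"

definition vderiv :: "vfield \<Rightarrow> (jet \<Rightarrow> 'b::real_normed_vector) \<Rightarrow> jet \<Rightarrow> 'b" where
  "vderiv X f p = frechet_derivative f (at p) (X p)"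

definition lie_bracket :: "vfield \<Rightarrow> vfield \<Rightarrow> vfield" where
  "lie_bracket X Y p = vderiv X Y p - vderiv Y X p"

definition partial_t :: vfield where "partial_t p = (1, 0, 0)"
definition partial_x :: "4 \<Rightarrow> vfield" where "partial_x i p = (0, axis i 1, 0)"
definition partial_y :: "4 \<Rightarrow> vfield" where "partial_y i p = (0, 0, axis i 1)"


definition time_metric :: "(real \<Rightarrow> real) \<Rightarrow> bool" where
  "time_metric h \<longleftrightarrow> (\<forall>t. h t > 0) \<and> (\<forall>n. (deriv ^^ n) h differentiable_on UNIV)"

definition kappa :: "(real \<Rightarrow> real) \<Rightarrow> real \<Rightarrow> real" where
  "kappa h t = (1 / h t) / 2 * deriv h t"

definition berwald_moor :: "(real \<Rightarrow> real) \<Rightarrow> jet \<Rightarrow> real" where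
  "berwald_moor h p = sqrt (1 / h (t_coord p)) * root 4 (\<Prod>i\<in>UNIV. y_coord i p)"

definition g_metric :: "(real \<Rightarrow> real) \<Rightarrow> 4 \<Rightarrow> 4 \<Rightarrow> jet \<Rightarrow> real" where
  "g_metric h i j p = h (t_coord p) / 2 *
     vderiv (partial_y i) (vderiv (partial_y j) (\<lambda>q. (berwald_moor h q)\<^sup>2)) p"

definition g_inv :: "(real \<Rightarrow> real) \<Rightarrow> 4 \<Rightarrow> 4 \<Rightarrow> jet \<Rightarrow> real" where
  "g_inv h j k p = matrix_inv (\<chi> a b. g_metric h a b p) $ j $ k"


text \<open>The nonlinear connection $M_{(1)1}^{(i)}$, $N_{(1)j}^{(i)}$ and its adapted bases.\<close>

definition M_conn :: "(real \<Rightarrow> real) \<Rightarrow> 4 \<Rightarrow> jet \<Rightarrow> real" where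
  "M_conn h i p = - kappa h (t_coord p) * y_coord i p"

definition N_conn :: "(real \<Rightarrow> real) \<Rightarrow> 4 \<Rightarrow> 4 \<Rightarrow> jet \<Rightarrow> real" where
  "N_conn h i j p = - (kappa h (t_coord p) / 3) * (if i = j then 1 else 0)"

datatype adapted = Dt | Dx 4 | Dy 4

lemma UNIV_adapted: "(UNIV :: adapted set) = insert Dt (range Dx \<union> range Dy)"
proof (intro set_eqI iffI)
  fix a :: adapted
  show "a \<in> insert Dt (range Dx \<union> range Dy)" by (cases a) auto
qed simp

instance adapted :: finite
proof
  show "finite (UNIV :: adapted set)" by (simp add: UNIV_adapted)
qed

text \<open>The vector fields $\delta/\delta t$, $\delta/\delta x^i$, $\partial/\partial y_1^i$.\<close>

fun frame :: "(real \<Rightarrow> real) \<Rightarrow> adapted \<Rightarrow> vfield" where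
  "frame h Dt p = partial_t p + (\<Sum>m\<in>UNIV. (kappa h (t_coord p) * y_coord m p) *\<^sub>R partial_y m p)"
| "frame h (Dx i) p = partial_x i p + (kappa h (t_coord p) / 3) *\<^sub>R partial_y i p"
| "frame h (Dy i) p = partial_y i p"

text \<open>
  The dual coframe $dt$, $dx^i$, $\delta y_1^i = dy_1^i + M_{(1)1}^{(i)} dt + N_{(1)j}^{(i)} dx^j$
  at the point \<open>p\<close>, applied to the tangent vector \<open>v\<close>.
\<close>

fun coframe :: "(real \<Rightarrow> real) \<Rightarrow> adapted \<Rightarrow> jet \<Rightarrow> jet \<Rightarrow> real" where
  "coframe h Dt p v = t_coord v"
| "coframe h (Dx i) p v = x_coord i v"
| "coframe h (Dy i) p v =
     y_coord i v + M_conn h i p * t_coord v + (\<Sum>j\<in>UNIV. N_conn h i j p * x_coord j v)"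

lemma fst_sum_prod: "fst (sum f A) = (\<Sum>a\<in>A. fst (f a))"
  by (induction A rule: infinite_finite_induct) auto

lemma snd_sum_prod: "snd (sum f A) = (\<Sum>a\<in>A. snd (f a))"
  by (induction A rule: infinite_finite_induct) auto

lemmas frame_coords = partial_t_def partial_x_def partial_y_def fst_sum_prod snd_sum_prod

lemma coframe_frame: "coframe h A p (frame h B p) = (if A = B then 1 else 0)"
  by (cases A; cases B)
     (auto simp: frame_coords M_conn_def N_conn_def axis_def
       if_distrib[of "\<lambda>u. _ * u"] sum.delta sum.delta' cong: if_cong)

lemma sum_adapted:
  "(\<Sum>A\<in>UNIV. f A) = f Dt + (\<Sum>i\<in>UNIV. f (Dx i)) + (\<Sum>i\<in>UNIV. f (Dy i))"
  for f :: "adapted \<Rightarrow> 'b::ab_group_add"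
proof -
  have "(\<Sum>A\<in>UNIV. f A) = f Dt + (\<Sum>A\<in>range Dx \<union> range Dy. f A)"
    unfolding UNIV_adapted by (subst sum.insert) auto
  also have "(\<Sum>A\<in>range Dx \<union> range Dy. f A) = sum f (range Dx) + sum f (range Dy)"
    by (rule sum.union_disjoint) auto
  also have "sum f (range Dx) = (\<Sum>i\<in>UNIV. f (Dx i))"
    by (subst sum.reindex) (auto simp: inj_def)
  also have "sum f (range Dy) = (\<Sum>i\<in>UNIV. f (Dy i))"
    by (subst sum.reindex) (auto simp: inj_def)
  finally show ?thesis by (simp add: add.assoc)
qed

lemma frame_expansion: "v = (\<Sum>A\<in>UNIV. coframe h A p v *\<^sub>R frame h A p)"
proof -
  have delta: "(\<Sum>j\<in>UNIV. f j * axis j (1::real) $ i) = f i"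
    "(\<Sum>j\<in>UNIV. f j * c * axis j (1::real) $ i / 3) = f i * c / 3" for f c and i :: 4
    by (simp_all add: axis_def if_distrib[of "\<lambda>u. _ * u"] flip: sum_divide_distrib cong: if_cong)
  have N: "(\<Sum>j\<in>UNIV. N_conn h i j p * x_coord j v) = - (kappa h (t_coord p) / 3) * x_coord i v" for i
  proof -
    have "(\<Sum>j\<in>UNIV. N_conn h i j p * x_coord j v)
        = (\<Sum>j\<in>UNIV. if i = j then - (kappa h (t_coord p) / 3) * x_coord i v else 0)"
      by (intro sum.cong refl) (auto simp: N_conn_def)
    then show ?thesis by simp
  qed
  show ?thesis
    by (simp add: sum_adapted prod_eq_iff vec_eq_iff frame_coords delta N M_conn_def)
qed


text \<open>The adapted components $G_{j1}^k$, $L_{jk}^i$, $C_{j(k)}^{i(1)}$.\<close>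

definition G_conn :: "(real \<Rightarrow> real) \<Rightarrow> 4 \<Rightarrow> 4 \<Rightarrow> jet \<Rightarrow> real" where
  "G_conn h k j p = (\<Sum>m\<in>UNIV. g_inv h k m p / 2 * vderiv (frame h Dt) (g_metric h m j) p)"

definition L_conn :: "(real \<Rightarrow> real) \<Rightarrow> 4 \<Rightarrow> 4 \<Rightarrow> 4 \<Rightarrow> jet \<Rightarrow> real" where
  "L_conn h i j k p = (\<Sum>m\<in>UNIV. g_inv h i m p / 2 *
     (vderiv (frame h (Dx k)) (g_metric h j m) p
    + vderiv (frame h (Dx j)) (g_metric h k m) p
    - vderiv (frame h (Dx m)) (g_metric h j k) p))"

definition C_conn :: "(real \<Rightarrow> real) \<Rightarrow> 4 \<Rightarrow> 4 \<Rightarrow> 4 \<Rightarrow> jet \<Rightarrow> real" where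
  "C_conn h i j k p = (\<Sum>m\<in>UNIV. g_inv h i m p / 2 * vderiv (partial_y k) (g_metric h j m) p)"

text \<open>\<open>cartan_coeff h A B\<close> is the covariant derivative of \<open>frame h B\<close> along \<open>frame h A\<close>.\<close>

fun cartan_coeff :: "(real \<Rightarrow> real) \<Rightarrow> adapted \<Rightarrow> adapted \<Rightarrow> vfield" where
  "cartan_coeff h Dt Dt p = kappa h (t_coord p) *\<^sub>R frame h Dt p"
| "cartan_coeff h Dt (Dx i) p = (\<Sum>k\<in>UNIV. G_conn h k i p *\<^sub>R frame h (Dx k) p)"
| "cartan_coeff h Dt (Dy i) p =
     (\<Sum>k\<in>UNIV. (G_conn h k i p - kappa h (t_coord p) * (if k = i then 1 else 0)) *\<^sub>R frame h (Dy k) p)"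
| "cartan_coeff h (Dx j) Dt p = 0"
| "cartan_coeff h (Dx j) (Dx i) p = (\<Sum>k\<in>UNIV. L_conn h k i j p *\<^sub>R frame h (Dx k) p)"
| "cartan_coeff h (Dx j) (Dy i) p = (\<Sum>k\<in>UNIV. L_conn h k i j p *\<^sub>R frame h (Dy k) p)"
| "cartan_coeff h (Dy j) Dt p = 0"
| "cartan_coeff h (Dy j) (Dx i) p = (\<Sum>k\<in>UNIV. C_conn h k i j p *\<^sub>R frame h (Dx k) p)"
| "cartan_coeff h (Dy j) (Dy i) p = (\<Sum>k\<in>UNIV. C_conn h k i j p *\<^sub>R frame h (Dy k) p)"

text \<open>
  The linear connection with these values on the adapted basis: for $Y = Y^B e_B$,
  $\nabla_X Y = X(Y^B) e_B + X^A Y^B \nabla_{e_A} e_B$.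
\<close>

definition cartan_nabla :: "(real \<Rightarrow> real) \<Rightarrow> vfield \<Rightarrow> vfield \<Rightarrow> vfield" where
  "cartan_nabla h X Y p =
     (\<Sum>B\<in>UNIV. vderiv X (\<lambda>q. coframe h B q (Y q)) p *\<^sub>R frame h B p)
   + (\<Sum>A\<in>UNIV. \<Sum>B\<in>UNIV. (coframe h A p (X p) * coframe h B p (Y p)) *\<^sub>R cartan_coeff h A B p)"

lemma cartan_nabla_frame: "cartan_nabla h (frame h A) (frame h B) p = cartan_coeff h A B p"
proof -
  have "vderiv X (\<lambda>q. coframe h C q (frame h B q)) p = 0" for X C
    by (simp add: vderiv_def coframe_frame frechet_derivative_const)
  moreover have "(\<Sum>C\<in>UNIV. \<Sum>D\<in>UNIV.
      (coframe h C p (frame h A p) * coframe h D p (frame h B p)) *\<^sub>R cartan_coeff h C D p)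
      = (\<Sum>C\<in>UNIV. \<Sum>D\<in>UNIV. if C = A \<and> D = B then cartan_coeff h A B p else 0)"
    by (intro sum.cong refl) (auto simp: coframe_frame)
  moreover have "\<dots> = (\<Sum>C\<in>UNIV. if C = A then cartan_coeff h A B p else 0)"
    by (intro sum.cong refl) auto
  ultimately show ?thesis
    unfolding cartan_nabla_def by simp
qed

definition cartan_torsion :: "(real \<Rightarrow> real) \<Rightarrow> vfield \<Rightarrow> vfield \<Rightarrow> vfield" where
  "cartan_torsion h X Y p = cartan_nabla h X Y p - cartan_nabla h Y X p - lie_bracket X Y p"


text \<open>
  The torsion d-tensors, as components in the adapted basis:
  \<open>tor_T1 h k j\<close> is $T_{1j}^k$, \<open>tor_R1 h k j\<close> is $R_{(1)1j}^{(k)}$,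
  \<open>tor_T h k i j\<close> is $T_{ij}^k$, \<open>tor_R h k i j\<close> is $R_{(1)ij}^{(k)}$,
  \<open>tor_P1 h k j\<close> is $P_{(1)1(j)}^{(k) (1)}$,
  \<open>tor_Ph h k i j\<close> is $P_{i(j)}^{k(1)}$, \<open>tor_Pv h k i j\<close> is $P_{(1)i(j)}^{(k) (1)}$,
  \<open>tor_S h k i j\<close> is $S_{(1)(i)(j)}^{(k)(1)(1)}$.
\<close>

definition tor_T1 :: "(real \<Rightarrow> real) \<Rightarrow> 4 \<Rightarrow> 4 \<Rightarrow> jet \<Rightarrow> real" where
  "tor_T1 h k j p = coframe h (Dx k) p (cartan_torsion h (frame h (Dx j)) (frame h Dt) p)"

definition tor_R1 :: "(real \<Rightarrow> real) \<Rightarrow> 4 \<Rightarrow> 4 \<Rightarrow> jet \<Rightarrow> real" where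
  "tor_R1 h k j p = coframe h (Dy k) p (cartan_torsion h (frame h (Dx j)) (frame h Dt) p)"

definition tor_T :: "(real \<Rightarrow> real) \<Rightarrow> 4 \<Rightarrow> 4 \<Rightarrow> 4 \<Rightarrow> jet \<Rightarrow> real" where
  "tor_T h k i j p = coframe h (Dx k) p (cartan_torsion h (frame h (Dx j)) (frame h (Dx i)) p)"

definition tor_R :: "(real \<Rightarrow> real) \<Rightarrow> 4 \<Rightarrow> 4 \<Rightarrow> 4 \<Rightarrow> jet \<Rightarrow> real" where
  "tor_R h k i j p = coframe h (Dy k) p (cartan_torsion h (frame h (Dx j)) (frame h (Dx i)) p)"

definition tor_P1 :: "(real \<Rightarrow> real) \<Rightarrow> 4 \<Rightarrow> 4 \<Rightarrow> jet \<Rightarrow> real" where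
  "tor_P1 h k j p = coframe h (Dy k) p (cartan_torsion h (frame h (Dy j)) (frame h Dt) p)"

definition tor_Ph :: "(real \<Rightarrow> real) \<Rightarrow> 4 \<Rightarrow> 4 \<Rightarrow> 4 \<Rightarrow> jet \<Rightarrow> real" where
  "tor_Ph h k i j p = coframe h (Dx k) p (cartan_torsion h (frame h (Dy j)) (frame h (Dx i)) p)"

definition tor_Pv :: "(real \<Rightarrow> real) \<Rightarrow> 4 \<Rightarrow> 4 \<Rightarrow> 4 \<Rightarrow> jet \<Rightarrow> real" where
  "tor_Pv h k i j p = coframe h (Dy k) p (cartan_torsion h (frame h (Dy j)) (frame h (Dx i)) p)"

definition tor_S :: "(real \<Rightarrow> real) \<Rightarrow> 4 \<Rightarrow> 4 \<Rightarrow> 4 \<Rightarrow> jet \<Rightarrow> real" where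
  "tor_S h k i j p = coframe h (Dy k) p (cartan_torsion h (frame h (Dy j)) (frame h (Dy i)) p)"

text \<open>
  The torsion of two adapted fields has no components besides those named above; together with
  \<open>coframe_frame\<close> these equations determine the eight d-tensors at \<open>p\<close>.
\<close>

definition torsion_decomposes_at :: "(real \<Rightarrow> real) \<Rightarrow> jet \<Rightarrow> bool" where
  "torsion_decomposes_at h p \<longleftrightarrow> (\<forall>i j.
     cartan_torsion h (frame h (Dx j)) (frame h Dt) p =
       (\<Sum>k\<in>UNIV. tor_T1 h k j p *\<^sub>R frame h (Dx k) p) + (\<Sum>k\<in>UNIV. tor_R1 h k j p *\<^sub>R frame h (Dy k) p) \<and>
     cartan_torsion h (frame h (Dx j)) (frame h (Dx i)) p =
       (\<Sum>k\<in>UNIV. tor_T h k i j p *\<^sub>R frame h (Dx k) p) + (\<Sum>k\<in>UNIV. tor_R h k i j p *\<^sub>R frame h (Dy k) p) \<and>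
     cartan_torsion h (frame h (Dy j)) (frame h Dt) p =
       (\<Sum>k\<in>UNIV. tor_P1 h k j p *\<^sub>R frame h (Dy k) p) \<and>
     cartan_torsion h (frame h (Dy j)) (frame h (Dx i)) p =
       (\<Sum>k\<in>UNIV. tor_Ph h k i j p *\<^sub>R frame h (Dx k) p) + (\<Sum>k\<in>UNIV. tor_Pv h k i j p *\<^sub>R frame h (Dy k) p) \<and>
     cartan_torsion h (frame h (Dy j)) (frame h (Dy i)) p =
       (\<Sum>k\<in>UNIV. tor_S h k i j p *\<^sub>R frame h (Dy k) p))"

end

theory Submission
  imports Defs
begin

text \<open>
  Write $P = y^1 y^2 y^3 y^4$ and $s_{ij} = 1 - 2\delta_{ij}$. The factor $1/h$ in the squared
  Berwald-Moor function $\frac{1}{h} \sqrt P$ cancels the factor $h$ in the definition of the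
  metric, so that $g_{ij} = \frac12 \partial_i \partial_j \sqrt P
  = \frac{s_{ij}}{8} \frac{\sqrt P}{y^i y^j}$ depends on the fibre coordinates alone. Everything
  about the Cartan connection follows from three properties of this function
  (derivatives are taken along the fibre).

  \<^item> It is homogeneous of degree 0, and the vertical part of $\delta/\delta t$ is $\varkappa$
    times the Euler field. Hence $\delta g/\delta t = 0$ and $G = 0$: \<open>G_conn_eq_0\<close>.

  \<^item> Its derivatives $\partial_k g_{ij}$ are third derivatives of $\frac12 \sqrt P$, hence totally
    symmetric: \<open>vderiv_g_metric_symmetric\<close>. So $C$ is symmetric in its lower indices.

  \<^item> It does not depend on $x$, so that $\delta/\delta x^k$ acts on it as
    $\frac{\varkappa}{3} \partial_k$. By the total symmetry two of the three terms of $L$ cancel,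
    and $L = \frac{\varkappa}{3} C$: \<open>L_conn_eq_C_conn\<close>.

  On the side of the nonlinear connection, the adapted frame has only two kinds of nonzero brackets
  (\<open>lie_bracket_frame\<close>):
  $[\delta/\delta x^j, \delta/\delta t] = \frac13 (\varkappa^2 - \varkappa') \partial/\partial y^j$
  and $[\partial/\partial y^j, \delta/\delta t] = \varkappa\, \partial/\partial y^j$. The second is
  compensated by the term $-\varkappa \delta_i^k$ in the connection, which kills $P_{(1)1(j)}$; the
  first is $-R_{(1)1j}$. The remaining torsion is $C$ on the pair $(\partial/\partial y^j,
  \delta/\delta x^i)$ horizontally and $-L = -\frac{\varkappa}{3} C$ vertically, everything else
  cancelling by the symmetry of $C$ and $L$.

  That the three surviving tensors can all be nonzero is seen for $h = \exp$, where
  $\varkappa = \frac12$ is constant, at a point with $y = (1,1,1,1)$.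
\<close>

section \<open>The metric in closed form\<close>

definition y_product :: "jet \<Rightarrow> real" where
  "y_product p = (\<Prod>i\<in>UNIV. y_coord i p)"

lemma y_coord_nonzero: "y_product p > 0 \<Longrightarrow> y_coord i p \<noteq> 0"
  by (metis UNIV_I finite less_irrefl prod_zero_iff y_product_def)

lemma has_derivative_y_coord: "(y_coord i has_derivative y_coord i) (at p)"
  by (intro bounded_linear_imp_has_derivative bounded_linear_vec_nth
      bounded_linear_compose[OF bounded_linear_vec_nth]
      bounded_linear_compose[OF bounded_linear_snd] bounded_linear_snd)

lemma has_derivative_t_coord: "(fst has_derivative fst) (at (p :: jet))"
  by (intro bounded_linear_imp_has_derivative bounded_linear_fst)

lemma open_y_product_pos: "open {p. y_product p > 0}"
  unfolding y_product_def by (intro open_Collect_less continuous_intros)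

text \<open>
  The metric is defined by nested derivatives, and its closed form is valid only where the product
  is positive. That set being open, a derivative may be computed from the closed form.
\<close>

lemma has_derivative_on_cone:
  assumes "(f has_derivative D) (at p)" and "y_product p > 0"
    and "\<And>q. y_product q > 0 \<Longrightarrow> f q = f' q"
  shows "(f' has_derivative D) (at p)"
  by (rule has_derivative_transform_within_open[OF assms(1) open_y_product_pos])
    (use assms in auto)

lemma vderiv_eqI: "(f has_derivative D) (at p) \<Longrightarrow> vderiv X f p = D (X p)"
  by (simp add: vderiv_def frechet_derivative_at[symmetric])

text \<open>
  Logarithmic differentiation: $d \log \sqrt P = \frac12 \sum_k dy^k / y^k$. The derivatives
  of the metric, too, are kept as multiples of the function being differentiated.
\<close>

lemma has_derivative_sqrt_y_product:
  assumes "y_product p > 0"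
  shows "((\<lambda>q. sqrt (y_product q)) has_derivative
     (\<lambda>v. sqrt (y_product p) * ((\<Sum>k\<in>UNIV. y_coord k v / y_coord k p) / 2))) (at p)"
proof -
  have rest: "(\<Prod>j\<in>UNIV - {k}. y_coord j p) = y_product p / y_coord k p" for k
    using y_coord_nonzero[OF assms, of k] unfolding y_product_def by (subst prod.remove[of UNIV k]) auto
  have "(y_product has_derivative
      (\<lambda>v. \<Sum>k\<in>UNIV. y_coord k v * (\<Prod>j\<in>UNIV - {k}. y_coord j p))) (at p)"
    unfolding y_product_def by (rule has_derivative_prod) (rule has_derivative_y_coord)
  then have *: "(y_product has_derivative
      (\<lambda>v. y_product p * (\<Sum>k\<in>UNIV. y_coord k v / y_coord k p))) (at p)"
    by (simp add: rest sum_distrib_left mult_ac)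
  have "y_product p * inverse (sqrt (y_product p)) = sqrt (y_product p)"
    using assms by (simp add: real_div_sqrt flip: divide_inverse)
  then have "(y_product p * s) * (inverse (sqrt (y_product p)) / 2) = sqrt (y_product p) * (s / 2)" for s
    by (metis (no_types, lifting) mult.assoc mult.commute times_divide_eq_right)
  with DERIV_compose_FDERIV[OF DERIV_real_sqrt[OF assms] *] show ?thesis
    by (simp only:)
qed

lemma berwald_moor_square:
  assumes "\<forall>t. h t > 0" and "y_product p > 0"
  shows "(berwald_moor h p)\<^sup>2 = 1 / h (t_coord p) * sqrt (y_product p)"
proof -
  have "root 4 (y_product p) = sqrt (sqrt (y_product p))"
    using real_root_mult_exp[of 2 2 "y_product p"] by (simp add: sqrt_def)
  then show ?thesis
    using assms less_imp_le[of 0 "h (t_coord p)"]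
    by (simp add: berwald_moor_def y_product_def[symmetric] power_mult_distrib)
qed

lemma time_metric_DERIV:
  assumes "time_metric h"
  shows "(h has_real_derivative deriv h t) (at t)"
    and "(deriv h has_real_derivative deriv (deriv h) t) (at t)"
proof -
  have "(deriv ^^ n) h differentiable at t" for n
    using assms by (simp add: time_metric_def differentiable_on_eq_differentiable_at)
  from this[of 0] this[of 1]
  show "(h has_real_derivative deriv h t) (at t)"
    "(deriv h has_real_derivative deriv (deriv h) t) (at t)"
    by (simp_all add: DERIV_deriv_iff_real_differentiable)
qed

text \<open>
  The numerical part of the metric: the matrix $J - 2I$, where $J$ has all entries 1.
\<close>

definition pair_sign :: "4 \<Rightarrow> 4 \<Rightarrow> real" where
  "pair_sign i j = (if i = j then -1 else 1)"

definition y_hessian :: "4 \<Rightarrow> 4 \<Rightarrow> jet \<Rightarrow> real" where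
  "y_hessian i j p = pair_sign i j / 8 * sqrt (y_product p) / (y_coord i p * y_coord j p)"

text \<open>
  The first derivative $\partial_j$ brings down the factor $1/(2y^j)$; differentiating
  $\sqrt P / (2 y^j)$ once more gives $\sqrt P / (4 y^i y^j)$, minus $\sqrt P / (2 (y^j)^2)$ if
  $i = j$. This is the source of the sign. The derivatives are total ones, hence the terms in
  $h'$, which vanish on vertical vectors.
\<close>

lemma g_metric_closed_form:
  assumes h: "time_metric h" and p: "y_product p > 0"
  shows "g_metric h i j p = y_hessian i j p"
proof -
  have pos: "\<forall>t. h t > 0" using h by (simp add: time_metric_def)
  have nz: "h t \<noteq> 0" for t using pos by (simp add: less_imp_neq[THEN not_sym])
  have inv_h: "((\<lambda>q. 1 / h (t_coord q)) has_derivative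
      (\<lambda>v. t_coord v * - (deriv h (t_coord q) / (h (t_coord q))\<^sup>2))) (at q)" for q :: jet
    by (rule DERIV_compose_FDERIV[OF _ has_derivative_t_coord])
      (auto intro!: derivative_eq_intros time_metric_DERIV(1)[OF h] simp: nz power2_eq_square)
  have first: "vderiv (partial_y j) (\<lambda>q. (berwald_moor h q)\<^sup>2) q
      = 1 / h (t_coord q) * (sqrt (y_product q) / (2 * y_coord j q))" if q: "y_product q > 0" for q
  proof -
    have D: "((\<lambda>q. (berwald_moor h q)\<^sup>2) has_derivative
        (\<lambda>v. 1 / h (t_coord q) * (sqrt (y_product q) * ((\<Sum>k\<in>UNIV. y_coord k v / y_coord k q) / 2))
           + t_coord v * - (deriv h (t_coord q) / (h (t_coord q))\<^sup>2) * sqrt (y_product q))) (at q)"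
      by (rule has_derivative_on_cone[OF has_derivative_mult[OF inv_h has_derivative_sqrt_y_product[OF q]] q])
        (simp add: berwald_moor_square[OF pos])
    show ?thesis
      unfolding vderiv_eqI[OF D]
      by (simp add: partial_y_def axis_def if_distrib[of "\<lambda>u. u / _"] cong: if_cong)
  qed
  have inv_y: "((\<lambda>q. 1 / (2 * y_coord j q)) has_derivative
      (\<lambda>v. - (y_coord j v / (2 * (y_coord j p)\<^sup>2)))) (at p)"
    using y_coord_nonzero[OF p]
    by (auto intro!: derivative_eq_intros has_derivative_y_coord simp: power2_eq_square field_simps)
  have D2: "(vderiv (partial_y j) (\<lambda>q. (berwald_moor h q)\<^sup>2) has_derivative
      (\<lambda>v. 1 / h (t_coord p) * (sqrt (y_product p) * - (y_coord j v / (2 * (y_coord j p)\<^sup>2))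
           + sqrt (y_product p) * ((\<Sum>k\<in>UNIV. y_coord k v / y_coord k p) / 2) * (1 / (2 * y_coord j p)))
         + t_coord v * - (deriv h (t_coord p) / (h (t_coord p))\<^sup>2)
           * (sqrt (y_product p) * (1 / (2 * y_coord j p))))) (at p)"
    by (rule has_derivative_on_cone[OF has_derivative_mult[OF inv_h
            has_derivative_mult[OF has_derivative_sqrt_y_product[OF p] inv_y]] p])
      (simp add: first)
  have "vderiv (partial_y i) (vderiv (partial_y j) (\<lambda>q. (berwald_moor h q)\<^sup>2)) p
     = 1 / h (t_coord p) * (sqrt (y_product p) * - ((if i = j then 1 else 0) / (2 * (y_coord j p)\<^sup>2))
       + sqrt (y_product p) * (1 / y_coord i p / 2) * (1 / (2 * y_coord j p)))"
    by (subst vderiv_eqI[OF D2])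
      (auto simp: partial_y_def axis_def if_distrib[of "\<lambda>u. u / _"] cong: if_cong)
  then show ?thesis
    unfolding g_metric_def y_hessian_def pair_sign_def
    using nz[of "t_coord p"] y_coord_nonzero[OF p, of i] y_coord_nonzero[OF p, of j]
    by (simp only:) (auto simp: field_simps power2_eq_square)
qed

text \<open>
  The logarithmic derivative of $\sqrt P / (y^i y^j)$. It has no components along $t$ and $x$.
\<close>

lemma has_derivative_g_metric:
  assumes h: "time_metric h" and p: "y_product p > 0"
  shows "(g_metric h i j has_derivative (\<lambda>v. y_hessian i j p *
     ((\<Sum>k\<in>UNIV. y_coord k v / y_coord k p) / 2
        - y_coord i v / y_coord i p - y_coord j v / y_coord j p))) (at p)"
proof -
  note nz = y_coord_nonzero[OF p, of i] y_coord_nonzero[OF p, of j]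
  have inv_y: "((\<lambda>q. pair_sign i j / 8 / (y_coord i q * y_coord j q)) has_derivative
      (\<lambda>v. - (pair_sign i j / 8 / (y_coord i p * y_coord j p)
        * (y_coord i v / y_coord i p + y_coord j v / y_coord j p)))) (at p)"
    using nz
    by (auto intro!: derivative_eq_intros has_derivative_y_coord simp: field_simps)
  have "((\<lambda>q. sqrt (y_product q) * (pair_sign i j / 8 / (y_coord i q * y_coord j q))) has_derivative
      (\<lambda>v. y_hessian i j p * ((\<Sum>k\<in>UNIV. y_coord k v / y_coord k p) / 2
        - y_coord i v / y_coord i p - y_coord j v / y_coord j p))) (at p)"
    by (rule has_derivative_eq_rhs[OF has_derivative_mult[OF has_derivative_sqrt_y_product[OF p] inv_y]])
      (simp add: y_hessian_def algebra_simps add_divide_distrib)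
  then show ?thesis
    by (rule has_derivative_on_cone) (use p in \<open>simp_all add: g_metric_closed_form[OF h] y_hessian_def\<close>)
qed

lemma vderiv_g_metric:
  assumes "time_metric h" and "y_product p > 0"
  shows "vderiv X (g_metric h i j) p = y_hessian i j p *
     ((\<Sum>k\<in>UNIV. y_coord k (X p) / y_coord k p) / 2
        - y_coord i (X p) / y_coord i p - y_coord j (X p) / y_coord j p)"
  by (rule vderiv_eqI[OF has_derivative_g_metric[OF assms]])

text \<open>
  The factor $s_{ij}(s_{ik} + s_{jk} - 1)$ is 3 if all three indices agree, $-1$ if exactly two of
  them do, and 1 if they are distinct; its symmetry is that of the third derivatives of
  $\sqrt P$.
\<close>

lemma vderiv_partial_y_g_metric:
  assumes "time_metric h" and "y_product p > 0"
  shows "vderiv (partial_y k) (g_metric h i j) p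
    = pair_sign i j * (pair_sign i k + pair_sign j k - 1) / 16 *
      (sqrt (y_product p) / (y_coord i p * (y_coord j p * y_coord k p)))"
proof -
  have "(\<Sum>l\<in>UNIV. y_coord l (partial_y k p) / y_coord l p) / 2
      - y_coord i (partial_y k p) / y_coord i p - y_coord j (partial_y k p) / y_coord j p
    = (pair_sign i k + pair_sign j k - 1) / (2 * y_coord k p)"
    by (auto simp: partial_y_def axis_def pair_sign_def if_distrib[of "\<lambda>u. u / _"] cong: if_cong)
  then show ?thesis
    unfolding vderiv_g_metric[OF assms] y_hessian_def by simp
qed

text \<open>
  $(J - 2I)^2 = J^2 - 4J + 4I = 4I$, since $J^2 = 4J$ in dimension 4.
\<close>

lemma pair_sign_matrix_square: "(\<Sum>m\<in>UNIV. pair_sign i m * pair_sign m j) = (if i = j then 4 else 0)"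
  using exhaust_4[of i] exhaust_4[of j] by (auto simp: pair_sign_def sum_4)

lemma matrix_inv_unique:
  fixes A B :: "'a::field ^ 'n ^ 'n"
  assumes "A ** B = mat 1"
  shows "matrix_inv A = B"
  unfolding matrix_inv_def
proof (rule some_equality)
  show "A ** B = mat 1 \<and> B ** A = mat 1"
    using assms matrix_left_right_inverse by blast
  show "B' = B" if "A ** B' = mat 1 \<and> B' ** A = mat 1" for B'
    using that assms by (metis matrix_mul_assoc matrix_mul_lid matrix_mul_rid)
qed

text \<open>
  Up to the diagonal scalings by $1/y^i$ the metric is $\frac{\sqrt P}{8} (J - 2I)$, and
  $J - 2I$ is 4 times its own inverse.
\<close>

lemma g_inv_closed_form:
  assumes h: "time_metric h" and p: "y_product p > 0"
  shows "g_inv h i j p = 2 * pair_sign i j * y_coord i p * y_coord j p / sqrt (y_product p)"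
proof -
  let ?A = "\<chi> a b. g_metric h a b p"
  let ?B = "\<chi> a b. 2 * pair_sign a b * y_coord a p * y_coord b p / sqrt (y_product p)"
  have s: "sqrt (y_product p) \<noteq> 0" using p by simp
  have "(\<Sum>m\<in>UNIV. y_hessian a m p * (2 * pair_sign m b * y_coord m p * y_coord b p / sqrt (y_product p)))
      = (\<Sum>m\<in>UNIV. pair_sign a m * pair_sign m b) * (y_coord b p / (4 * y_coord a p))" for a b
    unfolding sum_distrib_right
    by (intro sum.cong refl) (use s y_coord_nonzero[OF p] in \<open>simp add: y_hessian_def field_simps\<close>)
  then have "?A ** ?B = mat 1"
    using y_coord_nonzero[OF p]
    by (auto simp: matrix_matrix_mult_def mat_def vec_eq_iff g_metric_closed_form[OF h p] pair_sign_matrix_square)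
  then have "matrix_inv ?A = ?B"
    by (rule matrix_inv_unique)
  then show ?thesis by (simp add: g_inv_def)
qed

section \<open>The adapted coefficients\<close>

text \<open>These two transpositions generate the full symmetry in $i$, $j$, $k$.\<close>

lemma vderiv_g_metric_symmetric:
  assumes "time_metric h" and "y_product p > 0"
  shows "vderiv (partial_y k) (g_metric h i j) p = vderiv (partial_y i) (g_metric h k j) p"
    and "vderiv (partial_y k) (g_metric h i j) p = vderiv (partial_y k) (g_metric h j i) p"
proof -
  have "pair_sign i j * (pair_sign i k + pair_sign j k - 1)
      = pair_sign k j * (pair_sign k i + pair_sign j i - 1)"
    by (auto simp: pair_sign_def)
  moreover have "y_coord i p * (y_coord j p * y_coord k p)
      = y_coord k p * (y_coord j p * y_coord i p)"
    by simp
  ultimately show "vderiv (partial_y k) (g_metric h i j) p = vderiv (partial_y i) (g_metric h k j) p"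
    unfolding vderiv_partial_y_g_metric[OF assms] by (simp only:)
  have "pair_sign i j * (pair_sign i k + pair_sign j k - 1)
      = pair_sign j i * (pair_sign j k + pair_sign i k - 1)"
    by (auto simp: pair_sign_def)
  moreover have "y_coord i p * (y_coord j p * y_coord k p)
      = y_coord j p * (y_coord i p * y_coord k p)"
    by simp
  ultimately show "vderiv (partial_y k) (g_metric h i j) p = vderiv (partial_y k) (g_metric h j i) p"
    unfolding vderiv_partial_y_g_metric[OF assms] by (simp only:)
qed

lemma frame_Dt: "frame h Dt p = (1, 0, kappa h (t_coord p) *\<^sub>R snd (snd p))"
  by (simp add: prod_eq_iff vec_eq_iff frame_coords partial_y_def axis_def
      if_distrib[of "\<lambda>u. _ * u"] cong: if_cong)

lemma frame_Dx: "frame h (Dx i) p = (0, axis i 1, (kappa h (t_coord p) / 3) *\<^sub>R axis i 1)"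
  by (simp add: partial_x_def partial_y_def)

lemma frame_Dy: "frame h (Dy i) p = (0, 0, axis i 1)"
  by (simp add: partial_y_def)

declare frame.simps [simp del]

text \<open>
  Along $\delta/\delta t$ the logarithmic derivative of the metric is
  $\varkappa (\frac12 \cdot 4 - 1 - 1) = 0$: this is homogeneity of degree 0.
\<close>

lemma G_conn_eq_0:
  assumes h: "time_metric h" and p: "y_product p > 0"
  shows "G_conn h k j p = 0"
proof -
  have "vderiv (frame h Dt) (g_metric h m j) p = 0" for m
    using y_coord_nonzero[OF p] by (simp add: vderiv_g_metric[OF h p] frame_Dt)
  then show ?thesis by (simp add: G_conn_def)
qed

lemma vderiv_frame_Dx_g_metric:
  assumes h: "time_metric h" and p: "y_product p > 0"
  shows "vderiv (frame h (Dx k)) (g_metric h i j) p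
    = kappa h (t_coord p) / 3 * vderiv (partial_y k) (g_metric h i j) p"
proof -
  have "y_coord m (frame h (Dx k) p) = kappa h (t_coord p) / 3 * y_coord m (partial_y k p)" for m
    by (simp add: frame_Dx partial_y_def)
  then show ?thesis
    by (simp only: vderiv_g_metric[OF h p] times_divide_eq_right[symmetric] mult.assoc
        sum_distrib_left[symmetric] right_diff_distrib mult.left_commute)
qed

text \<open>
  With $\delta/\delta x^k$ acting as $\frac{\varkappa}{3} \partial_k$, the Christoffel bracket
  becomes $\frac{\varkappa}{3} (\partial_k g_{jm} + \partial_j g_{km} - \partial_m g_{jk})$, and by
  total symmetry its three terms are equal up to sign.
\<close>

lemma L_conn_eq_C_conn:
  assumes "time_metric h" and "y_product p > 0"
  shows "L_conn h i j k p = kappa h (t_coord p) / 3 * C_conn h i j k p"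
proof -
  let ?D = "\<lambda>k i j. vderiv (partial_y k) (g_metric h i j) p"
  have "vderiv (frame h (Dx k)) (g_metric h j m) p + vderiv (frame h (Dx j)) (g_metric h k m) p
      - vderiv (frame h (Dx m)) (g_metric h j k) p = kappa h (t_coord p) / 3 * ?D k j m" for m
  proof -
    have "?D j k m = ?D k j m"
      by (rule vderiv_g_metric_symmetric(1)[OF assms])
    moreover have "?D m j k = ?D j m k"
      by (rule vderiv_g_metric_symmetric(1)[OF assms])
    moreover have "?D j m k = ?D j k m"
      by (rule vderiv_g_metric_symmetric(2)[OF assms])
    ultimately show ?thesis
      unfolding vderiv_frame_Dx_g_metric[OF assms] by simp
  qed
  then have "L_conn h i j k p = (\<Sum>m\<in>UNIV. kappa h (t_coord p) / 3 * (g_inv h i m p / 2 * ?D k j m))"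
    by (simp only: L_conn_def mult.left_commute)
  then show ?thesis by (simp only: C_conn_def sum_distrib_left)
qed

lemma C_conn_symmetric:
  assumes "time_metric h" and "y_product p > 0"
  shows "C_conn h i j k p = C_conn h i k j p"
  unfolding C_conn_def vderiv_g_metric_symmetric(1)[OF assms, of k j] ..

section \<open>Brackets and torsion of the adapted frame\<close>

lemma kappa_DERIV:
  assumes h: "time_metric h"
  shows "(kappa h has_real_derivative deriv (kappa h) t) (at t)"
proof -
  have "h t \<noteq> 0" using h by (simp add: time_metric_def less_imp_neq[THEN not_sym])
  then have "(kappa h has_real_derivative
      (- deriv h t / (h t)\<^sup>2) / 2 * deriv h t + (1 / h t) / 2 * deriv (deriv h) t) (at t)"
    unfolding kappa_def[abs_def]
    by (auto intro!: derivative_eq_intros time_metric_DERIV[OF h] simp: power2_eq_square field_simps)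
  then show ?thesis by (simp add: DERIV_imp_deriv)
qed

lemma has_derivative_kappa:
  assumes "time_metric h"
  shows "((\<lambda>q::jet. kappa h (t_coord q)) has_derivative
     (\<lambda>v. t_coord v * deriv (kappa h) (t_coord p))) (at p)"
  by (rule DERIV_compose_FDERIV[OF kappa_DERIV[OF assms] has_derivative_t_coord])

lemma vderiv_frame:
  assumes h: "time_metric h"
  shows "vderiv X (frame h Dt) p = (0, 0, (t_coord (X p) * deriv (kappa h) (t_coord p)) *\<^sub>R snd (snd p)
      + kappa h (t_coord p) *\<^sub>R snd (snd (X p)))"
    and "vderiv X (frame h (Dx i)) p
      = (0, 0, (t_coord (X p) * deriv (kappa h) (t_coord p) / 3) *\<^sub>R axis i 1)"
    and "vderiv X (frame h (Dy i)) p = 0"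
proof -
  have y: "((\<lambda>q::jet. snd (snd q)) has_derivative (\<lambda>v. snd (snd v))) (at p)"
    by (intro bounded_linear_imp_has_derivative bounded_linear_compose[OF bounded_linear_snd]
        bounded_linear_snd)
  show "vderiv X (frame h Dt) p = (0, 0, (t_coord (X p) * deriv (kappa h) (t_coord p)) *\<^sub>R snd (snd p)
      + kappa h (t_coord p) *\<^sub>R snd (snd (X p)))"
    unfolding frame_Dt[abs_def]
    by (rule vderiv_eqI[THEN trans, OF has_derivative_Pair[OF has_derivative_const
            has_derivative_Pair[OF has_derivative_const
              has_derivative_scaleR[OF has_derivative_kappa[OF h] y]]]])
      simp
  show "vderiv X (frame h (Dx i)) p
      = (0, 0, (t_coord (X p) * deriv (kappa h) (t_coord p) / 3) *\<^sub>R axis i 1)"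
    unfolding frame_Dx[abs_def]
    by (rule vderiv_eqI[THEN trans])
      (auto intro!: has_derivative_Pair has_derivative_const has_derivative_scaleR_left
        bounded_linear.has_derivative[OF bounded_linear_divide] has_derivative_kappa[OF h])
  show "vderiv X (frame h (Dy i)) p = 0"
    unfolding frame_Dy[abs_def]
    by (rule vderiv_eqI[THEN trans]) (rule has_derivative_const, simp)
qed

lemma cartan_torsion_frame:
  "cartan_torsion h (frame h A) (frame h B) p
    = cartan_coeff h A B p - cartan_coeff h B A p - lie_bracket (frame h A) (frame h B) p"
  by (simp add: cartan_torsion_def cartan_nabla_frame)

lemma sum_kronecker_scaleR:
  "(\<Sum>k\<in>UNIV. (c * (if k = i then 1 else 0)) *\<^sub>R f k) = c *\<^sub>R f i"
  for f :: "'i::finite \<Rightarrow> 'b::real_vector"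
proof -
  have "(\<Sum>k\<in>UNIV. (c * (if k = i then 1 else 0)) *\<^sub>R f k)
      = (\<Sum>k\<in>UNIV. if k = i then c *\<^sub>R f k else 0)"
    by (intro sum.cong) auto
  then show ?thesis by simp
qed

text \<open>
  The coefficients of the frame depend on $t$ and $y$ only, so a nonzero bracket needs
  $\delta/\delta t$. For $[\delta/\delta x^j, \delta/\delta t]$, the vertical part
  $\frac{\varkappa}{3} \partial/\partial y^j$ of the first field acts on the Euler term of the second
  and contributes $\frac13 \varkappa^2$, while $\partial/\partial t$ acts on $\frac{\varkappa}{3}$
  and contributes $-\frac13 \varkappa'$.
\<close>

lemma lie_bracket_frame:
  assumes h: "time_metric h"
  shows "lie_bracket (frame h (Dx j)) (frame h Dt) p
      = (- (1 / 3 * (deriv (kappa h) (t_coord p) - kappa h (t_coord p) * kappa h (t_coord p))))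
          *\<^sub>R frame h (Dy j) p"
    and "lie_bracket (frame h (Dx j)) (frame h (Dx i)) p = 0"
    and "lie_bracket (frame h (Dy j)) (frame h Dt) p = kappa h (t_coord p) *\<^sub>R frame h (Dy j) p"
    and "lie_bracket (frame h (Dy j)) (frame h (Dx i)) p = 0"
    and "lie_bracket (frame h (Dy j)) (frame h (Dy i)) p = 0"
  unfolding lie_bracket_def vderiv_frame[OF h] frame_Dt frame_Dx frame_Dy
  by (simp_all add: prod_eq_iff scaleR_left_diff_distrib right_diff_distrib)

lemma sum_kronecker:
  "(\<Sum>m\<in>UNIV. f m * (if k = m then 1 else 0)) = f k" for f :: "'i::finite \<Rightarrow> real"
  by (simp add: if_distrib[of "\<lambda>u. _ * u"] cong: if_cong)

lemma torsion_Dx_Dt: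
  assumes h: "time_metric h" and p: "y_product p > 0"
  shows "cartan_torsion h (frame h (Dx j)) (frame h Dt) p
    = (1 / 3 * (deriv (kappa h) (t_coord p) - kappa h (t_coord p) * kappa h (t_coord p)))
        *\<^sub>R frame h (Dy j) p"
  by (simp add: cartan_torsion_frame lie_bracket_frame[OF h] G_conn_eq_0[OF h p])

lemma torsion_Dx_Dx:
  assumes h: "time_metric h" and p: "y_product p > 0"
  shows "cartan_torsion h (frame h (Dx j)) (frame h (Dx i)) p = 0"
  by (simp add: cartan_torsion_frame lie_bracket_frame[OF h] L_conn_eq_C_conn[OF h p]
      C_conn_symmetric[OF h p, of _ j i])

text \<open>
  The term $-\varkappa \delta_i^k$ of the connection is exactly what cancels the bracket with the
  Euler part of $\delta/\delta t$.
\<close>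

lemma torsion_Dy_Dt:
  assumes h: "time_metric h" and p: "y_product p > 0"
  shows "cartan_torsion h (frame h (Dy j)) (frame h Dt) p = 0"
  by (simp add: cartan_torsion_frame lie_bracket_frame[OF h] G_conn_eq_0[OF h p]
      sum_negf sum_kronecker_scaleR)

text \<open>
  Here the two covariant derivatives lie in different distributions, so they do not cancel: the
  horizontal part is $C$ and the vertical part is $-L$.
\<close>

lemma torsion_Dy_Dx:
  assumes h: "time_metric h" and p: "y_product p > 0"
  shows "cartan_torsion h (frame h (Dy j)) (frame h (Dx i)) p
    = (\<Sum>k\<in>UNIV. C_conn h k i j p *\<^sub>R frame h (Dx k) p)
      + (\<Sum>k\<in>UNIV. (- (1 / 3) * kappa h (t_coord p) * C_conn h k i j p) *\<^sub>R frame h (Dy k) p)"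
  by (simp add: cartan_torsion_frame lie_bracket_frame[OF h] L_conn_eq_C_conn[OF h p]
      C_conn_symmetric[OF h p, of _ j i] sum_negf)

lemma torsion_Dy_Dy:
  assumes h: "time_metric h" and p: "y_product p > 0"
  shows "cartan_torsion h (frame h (Dy j)) (frame h (Dy i)) p = 0"
  by (simp add: cartan_torsion_frame lie_bracket_frame[OF h] C_conn_symmetric[OF h p, of _ j i])

lemma coframe_add: "coframe h A p (v + w) = coframe h A p v + coframe h A p w"
  by (cases A) (simp_all add: algebra_simps sum.distrib)

lemma coframe_scaleR: "coframe h A p (c *\<^sub>R v) = c * coframe h A p v"
  by (cases A) (simp_all add: algebra_simps sum_distrib_left)

lemma coframe_0: "coframe h A p 0 = 0"
  using coframe_scaleR[of h A p 0 0] by simp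

lemma coframe_diff: "coframe h A p (v - w) = coframe h A p v - coframe h A p w"
  using coframe_add[of h A p v "- w"] coframe_scaleR[of h A p "-1" w] by simp

lemma coframe_sum: "coframe h A p (\<Sum>k\<in>I. f k) = (\<Sum>k\<in>I. coframe h A p (f k))"
  by (induction I rule: infinite_finite_induct) (simp_all add: coframe_0 coframe_add)

lemmas coframe_linear = coframe_add coframe_scaleR coframe_0 coframe_diff coframe_sum coframe_frame

lemma torsion_components:
  assumes h: "time_metric h" and p: "y_product p > 0"
  shows "tor_Pv h k i j p = - (1 / 3) * kappa h (t_coord p) * C_conn h k i j p"
    and "tor_Ph h k i j p = C_conn h k i j p"
    and "tor_R1 h k j p = 1 / 3 *
      (deriv (kappa h) (t_coord p) - kappa h (t_coord p) * kappa h (t_coord p)) *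
      (if k = j then 1 else 0)"
    and "tor_T1 h k j p = 0" and "tor_T h k i j p = 0" and "tor_R h k i j p = 0"
    and "tor_P1 h k j p = 0" and "tor_S h k i j p = 0"
  unfolding tor_Pv_def tor_Ph_def tor_R1_def tor_T1_def tor_T_def tor_R_def tor_P1_def tor_S_def
    torsion_Dx_Dt[OF h p] torsion_Dx_Dx[OF h p] torsion_Dy_Dt[OF h p] torsion_Dy_Dx[OF h p]
    torsion_Dy_Dy[OF h p]
  by (simp_all add: coframe_linear sum_kronecker sum_negf sum_divide_distrib[symmetric]
      del: coframe.simps)

lemma torsion_decomposes:
  assumes h: "time_metric h" and p: "y_product p > 0"
  shows "torsion_decomposes_at h p"
  unfolding torsion_decomposes_at_def torsion_components[OF h p]
    torsion_Dx_Dt[OF h p] torsion_Dx_Dx[OF h p] torsion_Dy_Dt[OF h p] torsion_Dy_Dx[OF h p]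
    torsion_Dy_Dy[OF h p] sum_kronecker_scaleR
  by simp

section \<open>Effectiveness of the three surviving tensors\<close>

text \<open>
  At $y = (1,1,1,1)$ one has $C^3_{12} = \frac{1}{16} \sum_m s_{3m} a_m$ with
  $a_m = 16\, \partial_2 g_{1m}$, which is $-1$ for $m = 1, 2$ and 1 for $m = 3, 4$. Only the term
  $m = 4$ is positive, so that $C^3_{12} = -\frac18$.
\<close>

lemma C_conn_nonzero:
  assumes h: "time_metric h" and y: "\<And>i. y_coord i p = 1"
  shows "C_conn h 3 1 2 p \<noteq> 0"
proof -
  have [simp]: "y_product p = 1" by (simp add: y_product_def y)
  then have p: "y_product p > 0" by simp
  show ?thesis
    by (simp add: C_conn_def sum_4 g_inv_closed_form[OF h p] vderiv_partial_y_g_metric[OF h p]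
        pair_sign_def y)
qed

lemma time_metric_exp: "time_metric exp"
proof -
  have "deriv (exp :: real \<Rightarrow> real) = exp"
    by (intro ext DERIV_imp_deriv DERIV_exp)
  then have "(deriv ^^ n) (exp :: real \<Rightarrow> real) = exp" for n
    by (induction n) simp_all
  then show ?thesis
    by (auto simp: time_metric_def differentiable_on_eq_differentiable_at real_differentiable_def
        intro: DERIV_exp)
qed

lemma kappa_exp: "kappa exp = (\<lambda>t. 1 / 2)"
  by (auto simp: kappa_def DERIV_imp_deriv[OF DERIV_exp])

lemma jet_domain_iff: "p \<in> jet_domain U \<longleftrightarrow> fst (snd p) \<in> U \<and> y_product p > 0"
  by (simp add: jet_domain_def y_product_def)

theorem theorem4p4:
  fixes U :: "(real ^ 4) set"
  assumes "open U" and "U \<noteq> {}"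
  shows "(\<forall>h. time_metric h \<longrightarrow> (\<forall>p\<in>jet_domain U.
            torsion_decomposes_at h p \<and>
            (\<forall>i j k :: 4.
               tor_Pv h k i j p = - (1 / 3) * kappa h (t_coord p) * C_conn h k i j p \<and>
               tor_Ph h k i j p = C_conn h k i j p \<and>
               tor_R1 h k j p = 1 / 3 *
                 (deriv (kappa h) (t_coord p) - kappa h (t_coord p) * kappa h (t_coord p)) *
                 (if k = j then 1 else 0) \<and>
               tor_T1 h k j p = 0 \<and>
               tor_T h k i j p = 0 \<and>
               tor_R h k i j p = 0 \<and>
               tor_P1 h k j p = 0 \<and>
               tor_S h k i j p = 0)))
       \<and> (\<exists>h. time_metric h \<and>
            (\<exists>p\<in>jet_domain U. \<exists>i j k. tor_Pv h k i j p \<noteq> 0) \<and>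
            (\<exists>p\<in>jet_domain U. \<exists>i j k. tor_Ph h k i j p \<noteq> 0) \<and>
            (\<exists>p\<in>jet_domain U. \<exists>j k. tor_R1 h k j p \<noteq> 0))"
proof (intro conjI[of "\<forall>h. _ h"] allI impI ballI)
  fix h p
  assume h: "time_metric h" and "p \<in> jet_domain U"
  then have "y_product p > 0" by (simp add: jet_domain_iff)
  note p = h this
  show "torsion_decomposes_at h p \<and>
            (\<forall>i j k :: 4.
               tor_Pv h k i j p = - (1 / 3) * kappa h (t_coord p) * C_conn h k i j p \<and>
               tor_Ph h k i j p = C_conn h k i j p \<and>
               tor_R1 h k j p = 1 / 3 *
                 (deriv (kappa h) (t_coord p) - kappa h (t_coord p) * kappa h (t_coord p)) *
                 (if k = j then 1 else 0) \<and>
               tor_T1 h k j p = 0 \<and>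
               tor_T h k i j p = 0 \<and>
               tor_R h k i j p = 0 \<and>
               tor_P1 h k j p = 0 \<and>
               tor_S h k i j p = 0)"
    by (intro conjI allI torsion_decomposes[OF p] torsion_components[OF p])
next
  obtain x where x: "x \<in> U" using assms(2) by blast
  define p :: jet where "p = (0, x, \<chi> i. 1)"
  have y: "y_coord i p = 1" for i by (simp add: p_def)
  have p: "y_product p > 0" by (simp add: y_product_def y)
  then have dom: "p \<in> jet_domain U" using x by (simp add: jet_domain_iff p_def)
  note tor = torsion_components[OF time_metric_exp p] and C = C_conn_nonzero[OF time_metric_exp y]
  (* The exponential has constant kappa = 1/2, so that kappa' - kappa^2 = -1/4. *)
  have "tor_Pv exp 3 1 2 p \<noteq> 0" "tor_Ph exp 3 1 2 p \<noteq> 0" "tor_R1 exp 1 1 p \<noteq> 0"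
    using C by (simp_all add: tor kappa_exp)
  then show "\<exists>h. time_metric h \<and>
            (\<exists>p\<in>jet_domain U. \<exists>i j k. tor_Pv h k i j p \<noteq> 0) \<and>
            (\<exists>p\<in>jet_domain U. \<exists>i j k. tor_Ph h k i j p \<noteq> 0) \<and>
            (\<exists>p\<in>jet_domain U. \<exists>j k. tor_R1 h k j p \<noteq> 0)"
    using dom time_metric_exp by blast
qed

end
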